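(* Let $\mathcal{G}(\mathcal{V},\mathcal{E})$ be a connected undirected graph (multiple edges between two vertices allowed) with $n_{\rm n}$ vertices and $n_{\rm e}$ edges, let $\boldsymbol{E}_{\mathcal{G}}\in\mathbb{R}^{n_{\rm n}\times n_{\rm e}}$ be its oriented incidence matrix for an arbitrary fixed orientation, and let $\boldsymbol{c}_{\rm nc}\in\mathbb{R}^{n_{\rm n}}$ be any uniquely-balanced vector. Then, for every sufficiently large constant $M>0$ (depending on $\mathcal{G}$ and $\boldsymbol{c}_{\rm nc}$) and every $\boldsymbol{z}\in\{0,1\}^{n_{\rm e}}$, the graph $\mathcal{G}_{\boldsymbol{z}}$ is connected if and only if there exist $\boldsymbol{\vartheta}\in\mathbb{R}^{n_{\rm n}}$ and $\boldsymbol{\rho}\in\mathbb{R}^{n_{\rm e}}$ satisfying (inequalities between vectors being entrywise) $$-M(\boldsymbol{1}-\boldsymbol{z})\le \boldsymbol{E}_{\mathcal{G}}^{\rm T}\boldsymbol{\vartheta}-\boldsymbol{\rho}\le M(\boldsymbol{1}-\boldsymbol{z}),$$ $$-M\boldsymbol{z}\le\boldsymbol{\rho}\le M\boldsymbol{z},$$ $$\boldsymbol{E}_{\mathcal{G}}\boldsymbol{\rho}=\boldsymbol{c}_{\rm nc}.$$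
   Context: $\mathcal{G}_{\boldsymbol{z}}$ denotes the subgraph of $\mathcal{G}$ with vertex set $\mathcal{V}$ and edge set $\{e\in\mathcal{E}: z_e=1\}$. The oriented incidence matrix $\boldsymbol{E}_{\mathcal{G}}$ has entry $1$ at $(i,j)$ if vertex $i$ is the starting vertex of edge $j$, $-1$ if $i$ is the end vertex of $j$, and $0$ otherwise. $\boldsymbol{1}$ is the all-ones vector. Let $\mathcal{V}_1,\dots,\mathcal{V}_{n_{\rm s}}$ be an enumeration of the vertex sets of all connected node-induced subgraphs of $\mathcal{G}$ (i.e., all nonempty $\mathcal{W}\subseteq\mathcal{V}$ such that the subgraph of $\mathcal{G}$ induced by $\mathcal{W}$ is connected), with $\mathcal{V}_1=\mathcal{V}$. Let $\boldsymbol{E}_{\rm ns}\in\mathbb{R}^{n_{\rm s}\times n_{\rm n}}$ be the matrix with $(i,j)$ entry equal to $1$ if $j\in\mathcal{V}_i$ and $0$ otherwise. For $\boldsymbol{c}_{\rm nc}\in\mathbb{R}^{n_{\rm n}}$ set $\boldsymbol{b}_{\rm nc}=\boldsymbol{E}_{\rm ns}\boldsymbol{c}_{\rm nc}$. The vector $\boldsymbol{c}_{\rm nc}$ is uniquely-balanced if $b_{{\rm nc},1}=0$ and $b_{{\rm nc},i}\neq 0$ for all $i\in\{2,\dots,n_{\rm s}\}$. *)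

theory Defs
  imports "Graph_Theory.Digraph_Component" "Jordan_Normal_Form.Matrix"
begin

text \<open>
  An undirected multigraph together with a fixed orientation of its edges is a \<open>pre_digraph\<close>
  without loops, parallel arcs being allowed: the arc \<open>e\<close> is the undirected edge between
  \<open>tail G e\<close> and \<open>head G e\<close>, oriented from \<open>tail G e\<close> to \<open>head G e\<close>.  Connectedness is that
  of the underlying undirected graph, which is what \<open>Digraph_Component.connected\<close> says (it
  symmetrises the arcs, and it requires a vertex).  \<open>Complex_Main\<close> has a topological notion
  of the same name, hence the abbreviation.  Vertices and edges are \<open>0, 1, \<dots>\<close>, so that they
  index vectors and matrices directly.
\<close>

abbreviation graph_connected :: "('a, 'b) pre_digraph \<Rightarrow> bool" where
  "graph_connected G \<equiv> Digraph_Component.connected G"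

definition oriented_multigraph :: "nat \<Rightarrow> nat \<Rightarrow> (nat, nat) pre_digraph \<Rightarrow> bool" where
  "oriented_multigraph n m G \<longleftrightarrow> loopfree_digraph G \<and> verts G = {..<n} \<and> arcs G = {..<m}"

definition incidence_matrix :: "nat \<Rightarrow> nat \<Rightarrow> (nat, nat) pre_digraph \<Rightarrow> real mat" where
  "incidence_matrix n m G =
     mat n m (\<lambda>(i, j). if i = tail G j then 1 else if i = head G j then -1 else 0)"

definition selected_subgraph :: "(nat, nat) pre_digraph \<Rightarrow> real vec \<Rightarrow> (nat, nat) pre_digraph" where
  "selected_subgraph G z = G\<lparr>arcs := {e \<in> arcs G. z $ e = 1}\<rparr>"

definition ones_vec :: "nat \<Rightarrow> real vec" where
  "ones_vec n = vec n (\<lambda>_. 1)"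

definition enumerates_connected_vertex_sets ::
    "nat set list \<Rightarrow> (nat, nat) pre_digraph \<Rightarrow> bool" where
  "enumerates_connected_vertex_sets Vs G \<longleftrightarrow>
     distinct Vs \<and>
     set Vs = {W. W \<noteq> {} \<and> W \<subseteq> verts G \<and> graph_connected (G \<restriction> W)} \<and>
     Vs ! 0 = verts G"

definition node_subgraph_matrix :: "nat set list \<Rightarrow> nat \<Rightarrow> real mat" where
  "node_subgraph_matrix Vs n = mat (length Vs) n (\<lambda>(i, j). if j \<in> Vs ! i then 1 else 0)"

text \<open>Lists are indexed from 0, so the full vertex set is the entry 0 of \<open>Vs\<close>.\<close>

definition uniquely_balanced :: "nat set list \<Rightarrow> nat \<Rightarrow> real vec \<Rightarrow> bool" where
  "uniquely_balanced Vs n c \<longleftrightarrow>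
     (let b = node_subgraph_matrix Vs n *\<^sub>v c
      in b $ 0 = 0 \<and> (\<forall>i \<in> {1..<length Vs}. b $ i \<noteq> 0))"

end

theory Submission
  imports Defs "Jordan_Normal_Form.Determinant"
begin

text \<open>
  If \<open>G\<^sub>z\<close> is disconnected, one of its components \<open>W\<close> is a proper vertex subset that induces a
  connected subgraph of \<open>G\<close>; pairing \<open>E \<rho> = c\<close> with the indicator vector of \<open>W\<close> shows that \<open>c\<close> is
  balanced on \<open>W\<close>, because \<open>\<rho>\<close> vanishes on all edges leaving \<open>W\<close>.  Conversely, if \<open>G\<^sub>z\<close> is connected,
  the kernel of its Laplacian \<open>L\<close> is spanned by \<open>\<one>\<close>, so \<open>L + \<one>\<one>\<^sup>T\<close> is invertible and the
  solution of \<open>(L + \<one>\<one>\<^sup>T) \<theta> = c\<close> solves \<open>L \<theta> = c\<close>, since \<open>c\<close> is orthogonal to \<open>\<one>\<close>.  As there are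
  only finitely many \<open>z\<close>, a single \<open>M\<close> bounds all these potentials and flows.
\<close>

section \<open>Connectedness and components\<close>

lemma connected_imp_constant:
  assumes "graph_connected H"
    and step: "\<And>e. e \<in> arcs H \<Longrightarrow> f (tail H e) = f (head H e)"
    and "u \<in> verts H" "v \<in> verts H"
  shows "f u = f v"
proof -
  have "(u, v) \<in> rtrancl_on (verts H) ((arcs_ends H)\<^sup>s)"
    using assms by (auto simp: connected_conv)
  then show ?thesis
    by (induct rule: rtrancl_on_induct) (auto simp: symcl_def arcs_ends_conv step)
qed

text \<open>Pick \<open>u\<close> and \<open>v\<close> not joined by a walk and let \<open>W\<close>
  be the component of \<open>u\<close>. It omits \<open>v\<close>, hence is proper, and no arc
  leaves or enters it.\<close>

lemma (in wf_digraph) not_connected_obtains_component: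
  assumes "verts G \<noteq> {}" and "\<not> graph_connected G"
  obtains W where "W \<noteq> {}" "W \<subset> verts G" "graph_connected (G \<restriction> W)"
    "\<And>e. e \<in> arcs G \<Longrightarrow> tail G e \<in> W \<longleftrightarrow> head G e \<in> W"
proof -
  \<comment> \<open>Reachability inside \<open>F\<close> with orientation ignored; it is needed both
    for \<open>G\<close> and for the subgraph induced by \<open>W\<close>.\<close>
  define R where "R F H = rtrancl_on F ((arcs_ends H)\<^sup>s)" for F and H :: "('a, 'b) pre_digraph"
  have symR: "(x, y) \<in> R F H \<Longrightarrow> (y, x) \<in> R F H" for x y F and H :: "('a, 'b) pre_digraph"
    unfolding R_def by (rule symD[OF rtrancl_on_sym]) (auto simp: symcl_def intro: symI)
  obtain u v where u: "u \<in> verts G" and v: "v \<in> verts G" and uv: "(u, v) \<notin> R (verts G) G"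
    using assms by (auto simp: connected_conv R_def)
  define W where "W = {w. (u, w) \<in> R (verts G) G}"
  have uW: "u \<in> W" using u by (auto simp: W_def R_def)
  have WV: "W \<subseteq> verts G" by (auto simp: W_def R_def dest: in_rtrancl_on_in_F)
  have closed: "y \<in> W" if "x \<in> W" "(x, y) \<in> (arcs_ends G)\<^sup>s" for x y
  proof -
    have "y \<in> verts G" using that(2) by (auto simp: symcl_def arcs_ends_conv)
    then show ?thesis using that by (auto simp: W_def R_def intro: rtrancl_on_into_rtrancl_on)
  qed
  \<comment> \<open>A walk from \<open>u\<close> never leaves \<open>W\<close>, so by induction
    along the walk it survives the restriction to \<open>W\<close>.\<close>
  have reach: "(u, w) \<in> R W (G \<restriction> W)" if "w \<in> W" for w
  proof -
    have "(u, w) \<in> rtrancl_on (verts G) ((arcs_ends G)\<^sup>s)" using that by (simp add: W_def R_def)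
    then show ?thesis
    proof (induct rule: rtrancl_on_induct)
      case base
      then show ?case using uW by (auto simp: R_def)
    next
      case (step y z)
      have y: "y \<in> W" using step by (simp add: W_def R_def)
      then have z: "z \<in> W" using closed step by blast
      have "(y, z) \<in> (arcs_ends (G \<restriction> W))\<^sup>s"
        using step(2) y z by (auto simp: symcl_def arcs_ends_conv)
      then show ?case using step(5) z by (auto simp: R_def intro: rtrancl_on_into_rtrancl_on)
    qed
  qed
  have "(x, y) \<in> R W (G \<restriction> W)" if "x \<in> W" "y \<in> W" for x y
    using symR[OF reach[OF that(1)]] reach[OF that(2)] unfolding R_def by (rule rtrancl_on_trans)
  then have "graph_connected (G \<restriction> W)"
    using uW by (auto simp: connected_conv R_def)
  moreover have "tail G e \<in> W \<longleftrightarrow> head G e \<in> W" if "e \<in> arcs G" for e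
  proof -
    have "(tail G e, head G e) \<in> arcs_ends G" using that by (auto simp: arcs_ends_conv)
    then have "(tail G e, head G e) \<in> (arcs_ends G)\<^sup>s" "(head G e, tail G e) \<in> (arcs_ends G)\<^sup>s"
      by (auto simp: symcl_def intro: rev_image_eqI)
    then show ?thesis using closed by blast
  qed
  moreover have "v \<notin> W" using uv by (simp add: W_def)
  ultimately show thesis using that[of W] uW WV v by blast
qed

section \<open>Linear algebra: solving a singular Gram system\<close>

lemma real_scalar_prod_self_eq_0_iff:
  fixes v :: "real vec"
  assumes "v \<in> carrier_vec n"
  shows "v \<bullet> v = 0 \<longleftrightarrow> v = 0\<^sub>v n"
  using assms by (auto simp: scalar_prod_def sum_nonneg_eq_0_iff)

lemma real_scalar_prod_self_nonneg:
  fixes v :: "real vec"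
  shows "0 \<le> v \<bullet> v"
  by (auto simp: scalar_prod_def intro: sum_nonneg)

lemma inj_mat_imp_surj:
  fixes A :: "'a :: field mat"
  assumes A: "A \<in> carrier_mat n n"
    and inj: "\<And>v. v \<in> carrier_vec n \<Longrightarrow> A *\<^sub>v v = 0\<^sub>v n \<Longrightarrow> v = 0\<^sub>v n"
    and c: "c \<in> carrier_vec n"
  obtains x where "x \<in> carrier_vec n" "A *\<^sub>v x = c"
proof -
  have "det A \<noteq> 0" using det_0_iff_vec_prod_zero_field[OF A] inj by auto
  \<comment> \<open>The value \<open>()\<close> only fills the extension slot of the matrix ring
    record.\<close>
  from det_non_zero_imp_unit[OF A this, of "()"]
  obtain B where B: "B \<in> carrier_mat n n" and AB: "A * B = 1\<^sub>m n"
    unfolding Units_def ring_mat_def by auto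
  have "A *\<^sub>v (B *\<^sub>v c) = c"
    using assoc_mult_mat_vec[OF A B c] AB c by simp
  then show thesis using that[of "B *\<^sub>v c"] B c by simp
qed

text \<open>Abstract form of the Laplacian argument: \<open>D * D\<^sup>T\<close> plays the
  Laplacian and \<open>u\<close> the all-ones vector. The rank-one term \<open>U\<close> removes the
  kernel, and orthogonality of \<open>c\<close> to \<open>u\<close> makes its contribution to the
  solution vanish.\<close>

lemma gram_solvable:
  fixes D :: "real mat"
  assumes D: "D \<in> carrier_mat n m" and u: "u \<in> carrier_vec n" and c: "c \<in> carrier_vec n"
    and Du: "D\<^sup>T *\<^sub>v u = 0\<^sub>v m"
    and ker: "\<And>v. v \<in> carrier_vec n \<Longrightarrow> D\<^sup>T *\<^sub>v v = 0\<^sub>v m \<Longrightarrow> \<exists>a. v = a \<cdot>\<^sub>v u"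
    and uc: "u \<bullet> c = 0"
  obtains \<theta> where "\<theta> \<in> carrier_vec n" "D *\<^sub>v (D\<^sup>T *\<^sub>v \<theta>) = c"
proof -
  define U where "U = mat n n (\<lambda>(i, j). u $ i * u $ j)"
  define A where "A = D * D\<^sup>T + U"
  have U: "U \<in> carrier_mat n n" and A: "A \<in> carrier_mat n n" using D by (auto simp: U_def A_def)
  have DT: "D\<^sup>T \<in> carrier_mat m n" using D by simp
  have Uv: "U *\<^sub>v v = (u \<bullet> v) \<cdot>\<^sub>v u" if "v \<in> carrier_vec n" for v
    using that u
    by (intro eq_vecI) (auto simp: U_def scalar_prod_def sum_distrib_left sum_distrib_right mult_ac)
  have Av: "A *\<^sub>v v = D *\<^sub>v (D\<^sup>T *\<^sub>v v) + (u \<bullet> v) \<cdot>\<^sub>v u" if v: "v \<in> carrier_vec n" for v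
    unfolding A_def using add_mult_distrib_mat_vec[OF _ U v, of "D * D\<^sup>T"] D DT v
    by (simp add: Uv assoc_mult_mat_vec[OF D DT v])
  \<comment> \<open>Used twice: with \<open>w = v\<close> for injectivity of \<open>A\<close>, and
    with \<open>w = u\<close> to discard the rank-one term.\<close>
  have wAv: "w \<bullet> (A *\<^sub>v v) = (D\<^sup>T *\<^sub>v w) \<bullet> (D\<^sup>T *\<^sub>v v) + (u \<bullet> v) * (w \<bullet> u)"
    if v: "v \<in> carrier_vec n" and w: "w \<in> carrier_vec n" for v w
  proof -
    have DTv: "D\<^sup>T *\<^sub>v v \<in> carrier_vec m" using DT v by simp
    have "w \<bullet> (A *\<^sub>v v) = w \<bullet> (D *\<^sub>v (D\<^sup>T *\<^sub>v v)) + w \<bullet> ((u \<bullet> v) \<cdot>\<^sub>v u)"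
      unfolding Av[OF v] using D DTv w u by (intro scalar_prod_add_distrib) auto
    then show ?thesis using transpose_vec_mult_scalar[OF D DTv w] w u by simp
  qed
  have "v = 0\<^sub>v n" if v: "v \<in> carrier_vec n" and 0: "A *\<^sub>v v = 0\<^sub>v n" for v
  proof -
    \<comment> \<open>A sum of two squares is zero, so \<open>v\<close> lies in the kernel of
      \<open>D\<^sup>T\<close> and is orthogonal to \<open>u\<close>. The kernel being spanned by
      \<open>u\<close>, \<open>v\<close> is orthogonal to itself.\<close>
    have "(D\<^sup>T *\<^sub>v v) \<bullet> (D\<^sup>T *\<^sub>v v) + (u \<bullet> v) * (u \<bullet> v) = 0"
      using wAv[OF v v] v u comm_scalar_prod[OF v u] by (simp add: 0)
    then have "(D\<^sup>T *\<^sub>v v) \<bullet> (D\<^sup>T *\<^sub>v v) = 0" and uv: "u \<bullet> v = 0"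
      using real_scalar_prod_self_nonneg[of "D\<^sup>T *\<^sub>v v"] zero_le_square[of "u \<bullet> v"]
      by (auto simp: add_nonneg_eq_0_iff)
    then have "D\<^sup>T *\<^sub>v v = 0\<^sub>v m"
      using real_scalar_prod_self_eq_0_iff[of "D\<^sup>T *\<^sub>v v" m] DT v by simp
    then obtain a where a: "v = a \<cdot>\<^sub>v u" using ker v by blast
    have "v \<bullet> v = a * (u \<bullet> v)" using a u v by simp
    then show ?thesis using real_scalar_prod_self_eq_0_iff[OF v] uv by simp
  qed
  then obtain \<theta> where \<theta>: "\<theta> \<in> carrier_vec n" and A\<theta>: "A *\<^sub>v \<theta> = c"
    using inj_mat_imp_surj[OF A _ c] by blast
  \<comment> \<open>Pairing the solved system with \<open>u\<close>: the Gram term vanishes since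
    \<open>D\<^sup>T\<close> kills \<open>u\<close>, and the right-hand side since
    \<open>u \<bullet> c = 0\<close>. Whichever factor is zero, the rank-one term is zero.\<close>
  have "(u \<bullet> \<theta>) * (u \<bullet> u) = 0"
    using wAv[OF \<theta> u] A\<theta> uc Du DT \<theta> by simp
  then have "(u \<bullet> \<theta>) \<cdot>\<^sub>v u = 0\<^sub>v n"
    using real_scalar_prod_self_eq_0_iff[OF u] u by auto
  then have "D *\<^sub>v (D\<^sup>T *\<^sub>v \<theta>) = c"
    using Av[OF \<theta>] A\<theta> D DT \<theta> by simp
  then show thesis using that \<theta> by blast
qed

section \<open>Incidence matrix, cuts and balance\<close>

lemma oriented_multigraph_tail_head:
  assumes "oriented_multigraph n m G" "e < m"
  shows "tail G e < n" "head G e < n" "tail G e \<noteq> head G e"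
proof -
  interpret loopfree_digraph G using assms by (simp add: oriented_multigraph_def)
  have "e \<in> arcs G" using assms by (simp add: oriented_multigraph_def)
  then show "tail G e < n" "head G e < n" "tail G e \<noteq> head G e"
    using tail_in_verts head_in_verts no_loops assms by (auto simp: oriented_multigraph_def)
qed

lemma incidence_matrix_carrier [simp]: "incidence_matrix n m G \<in> carrier_mat n m"
  by (simp add: incidence_matrix_def)

lemma transpose_incidence_mult_index:
  assumes "oriented_multigraph n m G" "x \<in> carrier_vec n" "e < m"
  shows "((incidence_matrix n m G)\<^sup>T *\<^sub>v x) $ e = x $ tail G e - x $ head G e"
proof -
  note te = oriented_multigraph_tail_head[OF assms(1,3)]
  have "((incidence_matrix n m G)\<^sup>T *\<^sub>v x) $ e
      = (\<Sum>i<n. (if i = tail G e then 1 else if i = head G e then -1 else 0) * x $ i)"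
    using assms(2,3) by (auto simp: incidence_matrix_def scalar_prod_def lessThan_atLeast0)
  \<comment> \<open>The nested conditional splits into a difference because tail and head are
    distinct.\<close>
  also have "\<dots> = (\<Sum>i<n. (if i = tail G e then x $ i else 0) - (if i = head G e then x $ i else 0))"
    using te(3) by (intro sum.cong) auto
  also have "\<dots> = x $ tail G e - x $ head G e"
    using te by (simp add: sum_subtractf)
  finally show ?thesis .
qed

text \<open>Transposing \<open>E\<close> turns the pairing into a sum of potential difference times
  flow over the edges, and in each term one factor is zero. With the indicator of a component as
  \<open>x\<close>, this says that the component has no net flow.\<close>

lemma potential_cut_balance:
  assumes G: "oriented_multigraph n m G"
    and x: "x \<in> carrier_vec n" and \<rho>: "\<rho> \<in> carrier_vec m"
    and cut: "\<And>e. e < m \<Longrightarrow> \<rho> $ e \<noteq> 0 \<Longrightarrow> x $ tail G e = x $ head G e"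
  shows "x \<bullet> (incidence_matrix n m G *\<^sub>v \<rho>) = 0"
proof -
  let ?E = "incidence_matrix n m G"
  have "x \<bullet> (?E *\<^sub>v \<rho>) = (?E\<^sup>T *\<^sub>v x) \<bullet> \<rho>"
    using transpose_vec_mult_scalar[OF incidence_matrix_carrier \<rho> x] by simp
  also have "\<dots> = (\<Sum>e<m. (?E\<^sup>T *\<^sub>v x) $ e * \<rho> $ e)"
    using \<rho> by (simp add: scalar_prod_def lessThan_atLeast0)
  also have "\<dots> = 0"
    using transpose_incidence_mult_index[OF G x] cut by (intro sum.neutral) force
  finally show ?thesis .
qed

text \<open>The indicator of \<open>W\<close> is a row of the node-subgraph matrix, so the scalar
  product is an entry of \<open>b\<close>, which is zero only at index 0.\<close>

lemma uniquely_balanced_scalar_prod: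
  assumes Vs: "enumerates_connected_vertex_sets Vs G" and c: "c \<in> carrier_vec n"
    and b: "uniquely_balanced Vs n c"
    and W: "W \<noteq> {}" "W \<subseteq> verts G" "graph_connected (G \<restriction> W)"
  shows "vec n (\<lambda>j. if j \<in> W then 1 else 0) \<bullet> c = 0 \<longleftrightarrow> W = verts G"
proof -
  have "W \<in> set Vs" using Vs W by (auto simp: enumerates_connected_vertex_sets_def)
  then obtain i where i: "i < length Vs" "Vs ! i = W" by (auto simp: in_set_conv_nth)
  have "(node_subgraph_matrix Vs n *\<^sub>v c) $ i = vec n (\<lambda>j. if j \<in> W then 1 else 0) \<bullet> c"
    using i by (auto simp: node_subgraph_matrix_def row_def intro!: arg_cong2[of _ _ _ _ scalar_prod])
  moreover have "(node_subgraph_matrix Vs n *\<^sub>v c) $ i = 0 \<longleftrightarrow> i = 0"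
    using b i by (cases "i = 0") (auto simp: uniquely_balanced_def Let_def)
  \<comment> \<open>Distinctness of \<open>Vs\<close> keeps the full vertex set from recurring at a
    later index.\<close>
  moreover have "i = 0 \<longleftrightarrow> W = verts G"
    using Vs i nth_eq_iff_index_eq[of Vs i 0]
    by (cases "Vs = []") (auto simp: enumerates_connected_vertex_sets_def)
  ultimately show ?thesis by simp
qed

section \<open>The two implications between flows and connectedness\<close>

lemma selected_subgraph_simps [simp]:
  "verts (selected_subgraph G z) = verts G"
  "arcs (selected_subgraph G z) = {e \<in> arcs G. z $ e = 1}"
  "tail (selected_subgraph G z) = tail G"
  "head (selected_subgraph G z) = head G"
  by (simp_all add: selected_subgraph_def)

lemma flow_imp_connected:
  assumes G: "oriented_multigraph n m G" and conn: "graph_connected G"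
    and Vs: "enumerates_connected_vertex_sets Vs G"
    and b: "uniquely_balanced Vs n c"
    and \<rho>: "\<rho> \<in> carrier_vec m"
    and supp: "\<And>e. e < m \<Longrightarrow> \<rho> $ e \<noteq> 0 \<Longrightarrow> z $ e = 1"
    and flow: "incidence_matrix n m G *\<^sub>v \<rho> = c"
  shows "graph_connected (selected_subgraph G z)"
proof (rule ccontr)
  interpret G: loopfree_digraph G using G by (simp add: oriented_multigraph_def)
  interpret H: wf_digraph "selected_subgraph G z"
    by unfold_locales auto
  assume "\<not> graph_connected (selected_subgraph G z)"
  moreover have "verts G \<noteq> {}" using conn by (simp add: connected_conv)
  ultimately obtain W where W: "W \<noteq> {}" "W \<subset> verts G"
    and Wc: "graph_connected (selected_subgraph G z \<restriction> W)"
    and cl: "\<And>e. e \<in> arcs (selected_subgraph G z) \<Longrightarrow> tail G e \<in> W \<longleftrightarrow> head G e \<in> W"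
    using H.not_connected_obtains_component by auto
  interpret GW: wf_digraph "G \<restriction> W" by (rule G.wellformed_induce_subgraph)
  interpret HW: wf_digraph "selected_subgraph G z \<restriction> W" by (rule H.wellformed_induce_subgraph)
  \<comment> \<open>Unique balance speaks of sets connected in \<open>G\<close>, whereas
    \<open>W\<close> is connected in the selected subgraph; restoring the unselected arcs on the
    same vertices preserves connectedness.\<close>
  have "spanning (selected_subgraph G z \<restriction> W) (G \<restriction> W)"
    unfolding spanning_def subgraph_def compatible_def
    using GW.wf_digraph_axioms HW.wf_digraph_axioms by auto
  then have GWc: "graph_connected (G \<restriction> W)"
    using Wc by (rule GW.connected_spanning_imp_connected)
  let ?x = "vec n (\<lambda>j. if j \<in> W then 1 else 0) :: real vec"
  have "?x \<bullet> (incidence_matrix n m G *\<^sub>v \<rho>) = 0"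
  proof (rule potential_cut_balance[OF G _ \<rho>])
    fix e assume e: "e < m" "\<rho> $ e \<noteq> 0"
    then have "e \<in> arcs (selected_subgraph G z)"
      using supp G by (simp add: oriented_multigraph_def)
    then show "?x $ tail G e = ?x $ head G e"
      using cl oriented_multigraph_tail_head[OF G e(1)] by simp
  qed simp
  moreover have "c \<in> carrier_vec n"
    using flow \<rho> incidence_matrix_carrier[of n m G] by (auto simp del: incidence_matrix_carrier)
  ultimately show False
    using uniquely_balanced_scalar_prod[OF Vs _ b, of W] flow W GWc by auto
qed

text \<open>Apply \<open>gram_solvable\<close> to the incidence matrix with its unselected columns
  zeroed. As \<open>z\<close> is binary, the Gram matrix is the Laplacian of the selected subgraph,
  and the flow on a selected edge is its potential difference.\<close>

lemma connected_imp_flow: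
  assumes G: "oriented_multigraph n m G"
    and z: "z \<in> carrier_vec m" "\<And>e. e < m \<Longrightarrow> z $ e \<in> {0, 1}"
    and conn: "graph_connected (selected_subgraph G z)"
    and c: "c \<in> carrier_vec n" and c0: "ones_vec n \<bullet> c = 0"
  obtains \<theta> \<rho> where "\<theta> \<in> carrier_vec n" "\<rho> \<in> carrier_vec m"
    "incidence_matrix n m G *\<^sub>v \<rho> = c"
    "\<And>e. e < m \<Longrightarrow> \<rho> $ e = z $ e * ((incidence_matrix n m G)\<^sup>T *\<^sub>v \<theta>) $ e"
proof -
  let ?E = "incidence_matrix n m G"
  define Z where "Z = mat_diag m (\<lambda>e. z $ e)"
  have E: "?E \<in> carrier_mat n m" and Z: "Z \<in> carrier_mat m m" by (simp_all add: Z_def)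
  have Zv: "(Z *\<^sub>v y) $ e = z $ e * y $ e" if "y \<in> carrier_vec m" "e < m" for y e
    using that by (simp add: Z_def mat_diag_def scalar_prod_def if_distrib[of "\<lambda>a. a * _"] cong: if_cong)
  have ZT: "Z\<^sup>T = Z" by (auto simp: Z_def mat_diag_def intro!: eq_matI)
  have DT: "(?E * Z)\<^sup>T *\<^sub>v x = Z *\<^sub>v (?E\<^sup>T *\<^sub>v x)" if "x \<in> carrier_vec n" for x
    using that E Z by (simp add: transpose_mult[OF E Z] ZT assoc_mult_mat_vec[of Z m m "?E\<^sup>T" n])
  have DTi: "((?E * Z)\<^sup>T *\<^sub>v x) $ e = z $ e * (x $ tail G e - x $ head G e)"
    if "x \<in> carrier_vec n" "e < m" for x e
  proof -
    have "?E\<^sup>T *\<^sub>v x \<in> carrier_vec m" using E that(1) by (intro mult_mat_vec_carrier) auto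
    then show ?thesis
      unfolding DT[OF that(1)] by (simp add: Zv that transpose_incidence_mult_index[OF G that])
  qed
  have "(?E * Z)\<^sup>T *\<^sub>v ones_vec n = 0\<^sub>v m"
  proof (rule eq_vecI)
    fix e assume "e < dim_vec (0\<^sub>v m :: real vec)"
    then show "((?E * Z)\<^sup>T *\<^sub>v ones_vec n) $ e = 0\<^sub>v m $ e"
      using oriented_multigraph_tail_head[OF G, of e] DTi[of "ones_vec n" e]
      by (simp add: ones_vec_def)
  qed (use Z in simp)
  moreover have "\<exists>a. v = a \<cdot>\<^sub>v ones_vec n"
    if v: "v \<in> carrier_vec n" and 0: "(?E * Z)\<^sup>T *\<^sub>v v = 0\<^sub>v m" for v
  proof -
    \<comment> \<open>A kernel vector agrees at the ends of every selected edge, hence is constant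
      by connectedness. Vertex 0 is the reference; it exists since \<open>i < n\<close>.\<close>
    have "v $ i = v $ 0" if "i < n" for i
    proof (rule connected_imp_constant[OF conn, of "\<lambda>i. v $ i"])
      fix e assume "e \<in> arcs (selected_subgraph G z)"
      then have "e < m" "z $ e = 1" using G by (auto simp: oriented_multigraph_def)
      then show "v $ tail (selected_subgraph G z) e = v $ head (selected_subgraph G z) e"
        using DTi[OF v, of e] by (simp add: 0)
    qed (use that G in \<open>auto simp: oriented_multigraph_def\<close>)
    then obtain a where "\<And>i. i < n \<Longrightarrow> v $ i = a" by blast
    then have "v = a \<cdot>\<^sub>v ones_vec n"
      using v by (intro eq_vecI) (auto simp: ones_vec_def)
    then show ?thesis ..
  qed
  ultimately obtain \<theta> where \<theta>: "\<theta> \<in> carrier_vec n"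
    and sol: "(?E * Z) *\<^sub>v ((?E * Z)\<^sup>T *\<^sub>v \<theta>) = c"
    using gram_solvable[of "?E * Z" n m "ones_vec n" c] E Z c c0 by (auto simp: ones_vec_def)
  \<comment> \<open>The Gram product yields \<open>Z\<close> twice; the second factor changes
    nothing because 0 and 1 are idempotent.\<close>
  let ?\<rho> = "Z *\<^sub>v (Z *\<^sub>v (?E\<^sup>T *\<^sub>v \<theta>))"
  have y: "?E\<^sup>T *\<^sub>v \<theta> \<in> carrier_vec m" using E \<theta> by (intro mult_mat_vec_carrier) auto
  show thesis
  proof (rule that[OF \<theta>])
    show "?\<rho> \<in> carrier_vec m" using Z y by simp
    show "?E *\<^sub>v ?\<rho> = c"
      using sol assoc_mult_mat_vec[OF E Z, of "Z *\<^sub>v (?E\<^sup>T *\<^sub>v \<theta>)"] Z y DT[OF \<theta>] by simp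
    show "?\<rho> $ e = z $ e * (?E\<^sup>T *\<^sub>v \<theta>) $ e" if "e < m" for e
      using z(2)[OF that] Zv[OF _ that, of "Z *\<^sub>v (?E\<^sup>T *\<^sub>v \<theta>)"] Zv[OF y that] Z y by auto
  qed
qed

section \<open>One constant for all edge selections\<close>

lemma finite_vec_over_finite:
  assumes "finite A"
  shows "finite {v \<in> carrier_vec m. \<forall>e < m. v $ e \<in> A}"
proof (rule finite_subset)
  show "{v \<in> carrier_vec m. \<forall>e < m. v $ e \<in> A} \<subseteq> vec_of_list ` {xs. set xs \<subseteq> A \<and> length xs = m}"
  proof
    fix v assume "v \<in> {v \<in> carrier_vec m. \<forall>e < m. v $ e \<in> A}"
    then have "set (list_of_vec v) \<subseteq> A" "length (list_of_vec v) = m"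
      by (auto simp: set_list_of_vec vec_set_def)
    then show "v \<in> vec_of_list ` {xs. set xs \<subseteq> A \<and> length xs = m}"
      by (intro image_eqI[of _ _ "list_of_vec v"]) (auto simp: vec_list)
  qed
qed (use assms in \<open>simp add: finite_lists_length_eq\<close>)

theorem theorem3p2:
  fixes n m :: nat
    and G :: "(nat, nat) pre_digraph"
    and Vs :: "nat set list"
    and c :: "real vec"
  assumes "oriented_multigraph n m G"
    and "graph_connected G"
    and "enumerates_connected_vertex_sets Vs G"
    and "c \<in> carrier_vec n"
    and "uniquely_balanced Vs n c"
  shows "\<exists>M\<^sub>0 > 0. \<forall>M \<ge> M\<^sub>0. \<forall>z \<in> carrier_vec m. (\<forall>e < m. z $ e \<in> {0, 1}) \<longrightarrow>
    (graph_connected (selected_subgraph G z) \<longleftrightarrow>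
      (\<exists>\<theta> \<in> carrier_vec n. \<exists>\<rho> \<in> carrier_vec m.
         (- M) \<cdot>\<^sub>v (ones_vec m - z) \<le> transpose_mat (incidence_matrix n m G) *\<^sub>v \<theta> - \<rho> \<and>
         transpose_mat (incidence_matrix n m G) *\<^sub>v \<theta> - \<rho> \<le> M \<cdot>\<^sub>v (ones_vec m - z) \<and>
         (- M) \<cdot>\<^sub>v z \<le> \<rho> \<and> \<rho> \<le> M \<cdot>\<^sub>v z \<and>
         incidence_matrix n m G *\<^sub>v \<rho> = c))"
proof -
  note G = assms(1) and c = assms(4)
  let ?E = "incidence_matrix n m G"
  define S where "S = {z \<in> carrier_vec m. \<forall>e < m. z $ e \<in> {0, 1 :: real}}"
  have S: "finite S" unfolding S_def by (rule finite_vec_over_finite) simp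
  define P where "P M z \<longleftrightarrow> (\<exists>\<theta> \<in> carrier_vec n. \<exists>\<rho> \<in> carrier_vec m.
         (- M) \<cdot>\<^sub>v (ones_vec m - z) \<le> ?E\<^sup>T *\<^sub>v \<theta> - \<rho> \<and> ?E\<^sup>T *\<^sub>v \<theta> - \<rho> \<le> M \<cdot>\<^sub>v (ones_vec m - z) \<and>
         (- M) \<cdot>\<^sub>v z \<le> \<rho> \<and> \<rho> \<le> M \<cdot>\<^sub>v z \<and> ?E *\<^sub>v \<rho> = c)" for M z
  have P_iff: "P M z \<longleftrightarrow> (\<exists>\<theta> \<in> carrier_vec n. \<exists>\<rho> \<in> carrier_vec m. ?E *\<^sub>v \<rho> = c \<and>
      (\<forall>e < m. \<bar>(?E\<^sup>T *\<^sub>v \<theta>) $ e - \<rho> $ e\<bar> \<le> M * (1 - z $ e) \<and> \<bar>\<rho> $ e\<bar> \<le> M * z $ e))"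
    if "z \<in> S" for M z
  proof -
    have "z \<in> carrier_vec m" using that by (simp add: S_def)
    then show ?thesis
      unfolding P_def
      by (intro bex_cong refl) (auto simp: less_eq_vec_def ones_vec_def abs_le_iff minus_le_iff)
  qed
  \<comment> \<open>For any \<open>M\<close>, the bound \<open>M * z $ e\<close> is zero on
    unselected edges, so the flow is supported on selected ones.\<close>
  have iffI: "graph_connected (selected_subgraph G z)" if z: "z \<in> S" and P: "P M z" for M z
  proof -
    from P[unfolded P_iff[OF z]] obtain \<rho> where \<rho>: "\<rho> \<in> carrier_vec m" "?E *\<^sub>v \<rho> = c"
      and "\<And>e. e < m \<Longrightarrow> \<bar>\<rho> $ e\<bar> \<le> M * z $ e" by blast
    then have "e < m \<Longrightarrow> \<rho> $ e \<noteq> 0 \<Longrightarrow> z $ e = 1" for e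
      using z by (force simp: S_def)
    then show ?thesis using flow_imp_connected[OF G assms(2,3,5) \<rho>(1) _ \<rho>(2)] by blast
  qed
  have V: "verts G = {..<n}" using G by (simp add: oriented_multigraph_def)
  interpret G: loopfree_digraph G using G by (simp add: oriented_multigraph_def)
  \<comment> \<open>Identifies the balance condition for the full vertex set with orthogonality of
    \<open>c\<close> to the all-ones vector.\<close>
  have GV: "G \<restriction> verts G = G"
    by (intro pre_digraph.equality) auto
  have ones: "vec n (\<lambda>j. if j \<in> verts G then 1 else 0) = ones_vec n"
    by (auto simp: ones_vec_def V)
  have c0: "ones_vec n \<bullet> c = 0"
    using uniquely_balanced_scalar_prod[OF assms(3) c assms(5), of "verts G"] assms(2)
    by (simp add: ones GV connected_conv)
  have "\<exists>M. \<forall>M' \<ge> M. P M' z" if z: "z \<in> S" and conn: "graph_connected (selected_subgraph G z)" for z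
  proof -
    obtain \<theta> \<rho> where \<theta>\<rho>: "\<theta> \<in> carrier_vec n" "\<rho> \<in> carrier_vec m" "?E *\<^sub>v \<rho> = c"
      and \<rho>: "\<And>e. e < m \<Longrightarrow> \<rho> $ e = z $ e * (?E\<^sup>T *\<^sub>v \<theta>) $ e"
      using connected_imp_flow[OF G _ _ conn c c0] z by (auto simp: S_def)
    \<comment> \<open>Dominates every potential difference. On a selected edge the residual is 0 and
      the flow is such a difference; on an unselected edge the roles are exchanged.\<close>
    define B where "B = (\<Sum>e<m. \<bar>(?E\<^sup>T *\<^sub>v \<theta>) $ e\<bar>)"
    have B: "\<bar>(?E\<^sup>T *\<^sub>v \<theta>) $ e\<bar> \<le> B" if "e < m" for e
      unfolding B_def using that by (intro member_le_sum) auto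
    have "P M z" if "B \<le> M" for M
    proof -
      have "\<bar>(?E\<^sup>T *\<^sub>v \<theta>) $ e - \<rho> $ e\<bar> \<le> M * (1 - z $ e) \<and> \<bar>\<rho> $ e\<bar> \<le> M * z $ e" if "e < m" for e
      proof -
        have "z $ e = 0 \<or> z $ e = 1" using z that by (auto simp: S_def)
        then show ?thesis using \<rho>[OF that] B[OF that] \<open>B \<le> M\<close> by auto
      qed
      then show ?thesis unfolding P_iff[OF z] using \<theta>\<rho> by blast
    qed
    then show ?thesis by blast
  qed
  then obtain Mz where Mz: "\<And>z M. z \<in> S \<Longrightarrow> graph_connected (selected_subgraph G z) \<Longrightarrow> Mz z \<le> M \<Longrightarrow> P M z"
    by metis
  \<comment> \<open>The sum dominates each threshold \<open>Mz z\<close>, and the summand 1 ensures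
    positivity.\<close>
  define M\<^sub>0 where "M\<^sub>0 = 1 + (\<Sum>z\<in>S. \<bar>Mz z\<bar>)"
  have "M\<^sub>0 > 0" unfolding M\<^sub>0_def by (intro add_pos_nonneg sum_nonneg) auto
  moreover have "Mz z \<le> M" if "M\<^sub>0 \<le> M" "z \<in> S" for M z
  proof -
    have "\<bar>Mz z\<bar> \<le> (\<Sum>z\<in>S. \<bar>Mz z\<bar>)" using S that(2) by (intro member_le_sum) auto
    then show ?thesis using that(1) by (simp add: M\<^sub>0_def)
  qed
  ultimately have "\<exists>M\<^sub>0 > 0. \<forall>M \<ge> M\<^sub>0. \<forall>z \<in> S. graph_connected (selected_subgraph G z) \<longleftrightarrow> P M z"
    using Mz iffI by blast
  then show ?thesis unfolding P_def S_def by fast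
qed

end
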